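(* Let $\mathbb{N}=C_1\sqcup C_2$ be a partition of $\mathbb{N}$ into two disjoint sets. Then there exist $i\in\{1,2\}$ and an infinite set $B\subseteq\mathbb{N}$ such that $B+B\subseteq C_i$.
   Context: $\mathbb{N}=\{1,2,3,\ldots\}$. For $B\subseteq\mathbb{N}$, $B+B=\{x+y:x,y\in B\}$; the case $x=y$ is allowed. *)

theory Defs
  imports "HOL-Analysis.Analysis" "HOL-Library.Set_Algebras"
begin

end

theory Submission
  imports Defs
begin

text \<open>
  Call \<open>c n = (2 * n \<in> C 1)\<close>. It suffices to find \<open>j\<close> and an infinite \<open>S\<close> such that \<open>c\<close> is constant on
  \<open>S + S + j\<close>, for then \<open>2 * S + j\<close> is as desired. If there are no such \<open>j\<close> and \<open>S\<close>, then for all nonprincipal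
  ultrafilters \<open>p\<close> on the naturals and all \<open>j\<close> (\<open>not_doubles_imp_sumset\<close>):

    (D)  the limit of \<open>c (2 * n + j)\<close> as \<open>n \<rightarrow> p\<close> is the opposite of the iterated limit of
         \<open>c (n + m + j)\<close> as \<open>m \<rightarrow> p\<close> and then \<open>n \<rightarrow> p\<close>.

  In short, \<open>c\<close> takes opposite values at \<open>2 * p + j\<close> and \<open>p + p + j\<close>. This is contradicted in two parts.

  The first part is a continuity argument (\<open>no_doubling_runs\<close>). Let \<open>A\<close> and \<open>B\<close> be disjoint sets such
  that, for all \<open>p\<close> and \<open>j\<close>, the sum \<open>p + p + j\<close> lies in \<open>A\<close> iff \<open>2 * p + j\<close> lies in \<open>B\<close>, and vice versa.
  By compactness, doubling maps a long interval inside \<open>A\<close> to one about twice as long inside \<open>B\<close>, and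
  conversely; likewise, a long stretch free of long intervals of one kind is doubled to a stretch free of
  those of the other kind. Suppose that a long interval inside \<open>A\<close> begins at \<open>s\<close>. Then there are long
  intervals of one kind at \<open>2 ^ k * s\<close> and of the other kind at \<open>2 ^ Suc k * s\<close>. Let \<open>r k\<close> be the first
  place beyond \<open>2 ^ k * s\<close> at which a long interval of the other kind begins. Doubling intervals and
  stretches between them shows that \<open>r (Suc k) - 2 * r k\<close> is bounded. Let \<open>p\<close> be a limit of the \<open>r k\<close> with
  \<open>k\<close> even. Within bounded distance of \<open>2 * p\<close> a long interval begins after an infinite stretch without
  others of its kind, hence the same holds at \<open>p + p\<close> for the kind of interval that begins at \<open>p\<close>.
  Going back from \<open>p + p\<close> to the last interval of this kind before the stretch gives intervals followed by
  arbitrarily long stretches free of their kind, but the double of such an interval and the double of the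
  stretch after it are incompatible.

  The second part (\<open>not_self_doubling\<close>) constructs such \<open>A\<close> and \<open>B\<close> from \<open>c\<close>, with arbitrarily long
  intervals inside \<open>A\<close>. Let \<open>p\<close> be an idempotent ultrafilter in a minimal left ideal and let
  \<open>x j\<close> be the limit of \<open>c (n + j)\<close> as \<open>n \<rightarrow> p\<close>. The sequence \<open>x\<close> is uniformly recurrent and
  \<open>x (n + j) \<rightarrow> x j\<close> as \<open>n \<rightarrow> p\<close>. By (D) and compactness, for large \<open>n\<close> the value \<open>c (2 * n)\<close> is the opposite
  of \<open>x n\<close> wherever \<open>c\<close> agrees from \<open>n\<close> on with a sufficiently long initial block of \<open>x\<close>, and it equals \<open>x n\<close>
  wherever \<open>c\<close> agrees there with the complement of that block. It follows that, on long intervals that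
  begin at elements of a set in \<open>p\<close>, the value \<open>c (2 * m)\<close> is the same at all occurrences \<open>m\<close> of the block
  or of its complement, and these occur with bounded gaps. The sets \<open>A\<close> and \<open>B\<close> record the two possible
  values.
\<close>

section \<open>Ultrafilters\<close>

text \<open>
  An ultrafilter is a proper filter that decides every predicate. It is nonprincipal iff it is finer
  than \<^const>\<open>sequentially\<close>. For an ultrafilter \<open>p\<close>, the truth value \<^term>\<open>eventually P p\<close> is the limit
  of \<open>P\<close> along \<open>p\<close>.
\<close>

definition ultra :: "'a filter \<Rightarrow> bool" where
  "ultra p \<longleftrightarrow> p \<noteq> bot \<and> (\<forall>P. eventually P p \<or> (\<forall>\<^sub>F x in p. \<not> P x))"

lemma ultra_neq_bot: "ultra p \<Longrightarrow> p \<noteq> bot"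
  by (simp add: ultra_def)

lemma ultra_not_eventually:
  assumes "ultra p"
  shows "(\<not> eventually P p) \<longleftrightarrow> (\<forall>\<^sub>F x in p. \<not> P x)"
proof
  assume "\<not> eventually P p"
  then show "\<forall>\<^sub>F x in p. \<not> P x" using assms by (auto simp: ultra_def)
next
  assume "\<forall>\<^sub>F x in p. \<not> P x"
  then show "\<not> eventually P p"
    using ultra_neq_bot[OF assms] eventually_frequently not_frequently by blast
qed

lemma ultra_eventually_eq:
  assumes "ultra p"
  shows "\<forall>\<^sub>F x in p. P x = eventually P p"
  using ultra_not_eventually[OF assms, of P] by (cases "eventually P p") auto

lemma ultra_eventually_iff:
  assumes "ultra p" "\<forall>\<^sub>F x in p. P x = b"
  shows "eventually P p = b"
proof (cases b)
  case False
  then have "\<forall>\<^sub>F x in p. \<not> P x" using assms(2) by simp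
  then show ?thesis using False ultra_not_eventually[OF assms(1)] by blast
qed (use assms in simp)

lemma ultra_eventually_bex:
  assumes "ultra p" "finite S" "\<forall>\<^sub>F x in p. \<exists>s\<in>S. P s x"
  shows "\<exists>s\<in>S. eventually (P s) p"
proof (rule ccontr)
  assume "\<not> ?thesis"
  then have "\<forall>s\<in>S. \<forall>\<^sub>F x in p. \<not> P s x"
    using ultra_not_eventually[OF assms(1)] by blast
  then have "\<forall>\<^sub>F x in p. \<forall>s\<in>S. \<not> P s x"
    by (rule eventually_ball_finite[OF assms(2)])
  with assms(3) have "\<forall>\<^sub>F x in p. False"
    by eventually_elim blast
  then show False using ultra_neq_bot[OF assms(1)] by simp
qed

lemma ultra_filtermap: "ultra p \<Longrightarrow> ultra (filtermap f p)"
  by (auto simp: ultra_def eventually_filtermap filtermap_bot_iff)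

text \<open>
  A filter stands for the closed set of the ultrafilters below it, a finer filter for a smaller set. Zorn's lemma in
  this form gives ultrafilters, minimal left ideals and minimal closed semigroups.
\<close>

lemma minimal_filter_exists:
  fixes F :: "'a filter"
  assumes "F \<noteq> bot" "\<Phi> F"
    and Inf: "\<And>\<C>. \<C> \<noteq> {} \<Longrightarrow> (\<And>G. G \<in> \<C> \<Longrightarrow> \<Phi> G) \<Longrightarrow> \<Phi> (Inf \<C>)"
  shows "\<exists>E\<le>F. E \<noteq> bot \<and> \<Phi> E \<and> (\<forall>G\<le>E. G \<noteq> bot \<longrightarrow> \<Phi> G \<longrightarrow> G = E)"
proof -
  define \<A> where "\<A> = {G. G \<le> F \<and> G \<noteq> bot \<and> \<Phi> G}"
  have "\<exists>m\<in>\<A>. \<forall>a\<in>\<A>. m \<ge> a \<longrightarrow> a = m"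
  proof (rule predicate_Zorn)
    show "partial_order_on \<A> (relation_of (\<ge>) \<A>)"
      by (rule partial_order_on_relation_ofI) auto
  next
    fix \<C> assume C: "\<C> \<in> Chains (relation_of (\<ge>) \<A>)"
    show "\<exists>u\<in>\<A>. \<forall>a\<in>\<C>. a \<ge> u"
    proof (cases "\<C> = {}")
      case True
      then show ?thesis using assms by (auto simp: \<A>_def)
    next
      case False
      have sub: "G \<in> \<A>" if "G \<in> \<C>" for G
        using C that by (auto simp: Chains_def relation_of_def)
      have lin: "G \<le> H \<or> H \<le> G" if "G \<in> \<C>" "H \<in> \<C>" for G H
        using C that by (auto simp: Chains_def relation_of_def)
      have ev: "eventually P (Inf \<C>) \<longleftrightarrow> (\<exists>G\<in>\<C>. eventually P G)" for P
      proof (rule eventually_Inf_base[OF False])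
        fix G H assume "G \<in> \<C>" "H \<in> \<C>"
        then show "\<exists>x\<in>\<C>. x \<le> inf G H"
          using lin[of G H] by (metis inf.absorb1 inf.absorb2 order_refl)
      qed
      have "Inf \<C> \<noteq> bot"
        using ev[of "\<lambda>_. False"] sub by (auto simp: \<A>_def)
      moreover have "\<Phi> (Inf \<C>)"
        using Inf[OF False] sub by (auto simp: \<A>_def)
      moreover have "Inf \<C> \<le> F"
        using False sub by (metis (mono_tags, lifting) Inf_lower2 \<A>_def all_not_in_conv mem_Collect_eq)
      ultimately show ?thesis by (auto simp: \<A>_def intro!: bexI[of _ "Inf \<C>"] Inf_lower)
    qed
  qed
  then obtain E where "E \<in> \<A>" "\<And>a. a \<in> \<A> \<Longrightarrow> a \<le> E \<Longrightarrow> a = E" by blast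
  then show ?thesis
    by (intro exI[of _ E]) (auto simp: \<A>_def)
qed

lemma ultra_le_exists:
  assumes "F \<noteq> bot"
  obtains p where "ultra p" "p \<le> F"
proof -
  obtain E where E: "E \<le> F" "E \<noteq> bot" and min: "\<And>G. G \<le> E \<Longrightarrow> G \<noteq> bot \<Longrightarrow> G = E"
    using minimal_filter_exists[OF assms, of "\<lambda>_. True"] by auto
  have "ultra E" unfolding ultra_def
  proof (intro conjI allI)
    fix P
    show "eventually P E \<or> (\<forall>\<^sub>F x in E. \<not> P x)"
    proof (cases "inf E (principal {x. P x}) = bot")
      case True
      then have "eventually (\<lambda>_. False) (inf E (principal {x. P x}))" by simp
      then show ?thesis by (simp add: eventually_inf_principal)
    next
      case False
      then have "inf E (principal {x. P x}) = E" by (intro min) auto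
      moreover have "eventually P (inf E (principal {x. P x}))"
        by (simp add: eventually_inf_principal)
      ultimately show ?thesis by simp
    qed
  qed (fact E(2))
  then show ?thesis using E(1) that by blast
qed

lemma filter_le_via_ultra:
  assumes "\<And>p. ultra p \<Longrightarrow> p \<le> F \<Longrightarrow> p \<le> G"
  shows "F \<le> G"
proof (rule filter_leI, rule ccontr)
  fix P assume P: "eventually P G" and n: "\<not> eventually P F"
  have "inf F (principal {x. \<not> P x}) \<noteq> bot"
  proof
    assume "inf F (principal {x. \<not> P x}) = bot"
    then have "eventually (\<lambda>_. False) (inf F (principal {x. \<not> P x}))" by simp
    then show False using n by (simp add: eventually_inf_principal)
  qed
  then obtain p where p: "ultra p" "p \<le> inf F (principal {x. \<not> P x})"
    by (rule ultra_le_exists)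
  then have "eventually P p" using assms P by (metis filter_leD le_infE)
  moreover have "\<forall>\<^sub>F x in p. \<not> P x"
    using p(2) by (simp add: le_principal)
  ultimately show False using ultra_not_eventually[OF p(1)] by blast
qed

text \<open>
  Compactness: conditions of increasing strength that can be met one at a time by arbitrarily large
  numbers are met together by a nonprincipal ultrafilter.
\<close>

lemma ultra_sequence:
  fixes Q :: "nat \<Rightarrow> nat \<Rightarrow> bool"
  assumes ex: "\<And>M. \<exists>n\<ge>M. Q M n"
    and anti: "\<And>M N n. M \<le> N \<Longrightarrow> Q N n \<Longrightarrow> Q M n"
  obtains p where "ultra p" "p \<le> sequentially" "\<And>M. eventually (Q M) p"
proof -
  define F where "F = (INF M. principal {n. n \<ge> M \<and> Q M n})"
  have ev: "eventually P F \<longleftrightarrow> (\<exists>M. \<forall>n. n \<ge> M \<and> Q M n \<longrightarrow> P n)" for P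
    unfolding F_def
  proof (subst eventually_INF_base)
    fix a b :: nat
    show "\<exists>x\<in>UNIV. principal {n. n \<ge> x \<and> Q x n}
        \<le> inf (principal {n. n \<ge> a \<and> Q a n}) (principal {n. n \<ge> b \<and> Q b n})"
      by (rule bexI[of _ "max a b"]) (auto intro: anti[rotated])
  qed (auto simp: eventually_principal)
  have "F \<noteq> bot"
    using ev[of "\<lambda>_. False"] ex by auto
  then obtain p where p: "ultra p" "p \<le> F" by (rule ultra_le_exists)
  have "F \<le> sequentially"
    by (rule filter_leI) (auto simp: ev eventually_sequentially)
  moreover have "eventually (Q M) F" for M using ev by blast
  ultimately show ?thesis using that p by (meson filter_leD order_trans)
qed

lemma eventually_ge_nonprincipal: "p \<le> sequentially \<Longrightarrow> \<forall>\<^sub>F n in p. k \<le> n"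
  for k :: nat
  by (rule filter_leD[OF _ eventually_ge_at_top])

section \<open>Idempotent ultrafilters\<close>

text \<open>
  The sum of filters that extends addition to ultrafilters: the limit along \<open>fsum p q\<close> is the iterated
  limit, the inner one along \<open>q\<close>. It is continuous in its first argument.
\<close>

definition fsum :: "nat filter \<Rightarrow> nat filter \<Rightarrow> nat filter" where
  "fsum p q = Abs_filter (\<lambda>P. \<forall>\<^sub>F n in p. \<forall>\<^sub>F m in q. P (n + m))"

lemma eventually_fsum:
  "eventually P (fsum p q) \<longleftrightarrow> (\<forall>\<^sub>F n in p. \<forall>\<^sub>F m in q. P (n + m))"
  unfolding fsum_def
proof (rule eventually_Abs_filter, rule is_filter.intro)
  fix P Q :: "nat \<Rightarrow> bool"
  assume "\<forall>\<^sub>F n in p. \<forall>\<^sub>F m in q. P (n + m)" "\<forall>\<^sub>F n in p. \<forall>\<^sub>F m in q. Q (n + m)"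
  then show "\<forall>\<^sub>F n in p. \<forall>\<^sub>F m in q. P (n + m) \<and> Q (n + m)"
    by eventually_elim (rule eventually_conj)
next
  fix P Q :: "nat \<Rightarrow> bool"
  assume PQ: "\<forall>x. P x \<longrightarrow> Q x" and ev: "\<forall>\<^sub>F n in p. \<forall>\<^sub>F m in q. P (n + m)"
  from ev show "\<forall>\<^sub>F n in p. \<forall>\<^sub>F m in q. Q (n + m)"
    by (rule eventually_mono, elim eventually_mono) (use PQ in blast)
qed simp

lemma ultra_fsum:
  assumes "ultra p" "ultra q"
  shows "ultra (fsum p q)"
  unfolding ultra_def
proof (intro conjI allI)
  show "fsum p q \<noteq> bot"
    using assms[THEN ultra_neq_bot]
    by (simp add: eventually_fsum flip: eventually_False)
next
  fix P
  show "eventually P (fsum p q) \<or> (\<forall>\<^sub>F x in fsum p q. \<not> P x)"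
    unfolding eventually_fsum
    by (simp add: disj_imp ultra_not_eventually[OF assms(1)] ultra_not_eventually[OF assms(2)])
qed

lemma fsum_mono: "p \<le> p' \<Longrightarrow> fsum p q \<le> fsum p' q"
  by (rule filter_leI) (auto simp: eventually_fsum dest: filter_leD)

lemma fsum_assoc: "fsum (fsum p q) r = fsum p (fsum q r)"
  by (simp add: filter_eq_iff eventually_fsum add.assoc)

lemma ultra_le_imp_eq:
  assumes "ultra p" "ultra q" "p \<le> q"
  shows "p = q"
proof (rule antisym[OF assms(3)], rule filter_leI)
  fix P assume "eventually P p"
  then show "eventually P q"
    using assms ultra_not_eventually by (metis filter_leD)
qed

text \<open>
  Right translation by \<open>p\<close> maps the closed set of ultrafilters below \<open>E\<close> onto that below \<open>fsum E p\<close>.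
\<close>

lemma ultra_le_fsum:
  assumes "ultra g" "ultra p" "g \<le> fsum E p"
  obtains q where "ultra q" "q \<le> E" "g = fsum q p"
proof -
  \<comment> \<open>The ultrafilters below \<open>F\<close> are the solutions \<open>q\<close> below \<open>E\<close>; that \<open>F\<close> is proper is compactness.\<close>
  define F where "F = inf E (INF P\<in>{P. eventually P g}. principal {n. \<forall>\<^sub>F m in p. P (n + m)})"
  have ev: "eventually R F \<longleftrightarrow> (\<exists>P. eventually P g \<and> (\<forall>\<^sub>F n in E. (\<forall>\<^sub>F m in p. P (n + m)) \<longrightarrow> R n))"
    for R
  proof -
    have "eventually R F \<longleftrightarrow> eventually R (INF P\<in>{P. eventually P g}. inf E (principal {n. \<forall>\<^sub>F m in p. P (n + m)}))"
      unfolding F_def by (subst INF_inf_const1) (auto intro: exI[of _ "\<lambda>_. True"])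
    also have "\<dots> \<longleftrightarrow> (\<exists>P\<in>{P. eventually P g}. eventually R (inf E (principal {n. \<forall>\<^sub>F m in p. P (n + m)})))"
    proof (rule eventually_INF_base)
      show "{P. eventually P g} \<noteq> {}" by (auto intro: exI[of _ "\<lambda>_. True"])
    next
      fix P Q assume "P \<in> {P. eventually P g}" "Q \<in> {P. eventually P g}"
      then show "\<exists>x\<in>{P. eventually P g}. inf E (principal {n. \<forall>\<^sub>F m in p. x (n + m)})
          \<le> inf (inf E (principal {n. \<forall>\<^sub>F m in p. P (n + m)})) (inf E (principal {n. \<forall>\<^sub>F m in p. Q (n + m)}))"
        by (intro bexI[of _ "\<lambda>x. P x \<and> Q x"])
           (auto simp: eventually_conj_iff intro!: le_infI le_infI2)
    qed
    finally show ?thesis by (auto simp: eventually_inf_principal)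
  qed
  have "F \<noteq> bot"
  proof
    assume "F = bot"
    then have "eventually (\<lambda>_. False) F" by simp
    then obtain P where P: "eventually P g" "\<forall>\<^sub>F n in E. \<not> (\<forall>\<^sub>F m in p. P (n + m))"
      unfolding ev by auto
    then have "\<forall>\<^sub>F x in fsum E p. \<not> P x"
      unfolding eventually_fsum using ultra_not_eventually[OF assms(2)] by simp
    then have "\<forall>\<^sub>F x in g. \<not> P x" using assms(3) by (rule filter_leD[rotated])
    then show False using P(1) ultra_not_eventually[OF assms(1)] by blast
  qed
  then obtain q where q: "ultra q" "q \<le> F" by (rule ultra_le_exists)
  have "fsum q p \<le> g"
  proof (rule filter_leI)
    fix P assume "eventually P g"
    then have "eventually (\<lambda>n. \<forall>\<^sub>F m in p. P (n + m)) F" unfolding ev by auto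
    then show "eventually P (fsum q p)"
      unfolding eventually_fsum using q(2) by (rule filter_leD[rotated])
  qed
  then have "g = fsum q p"
    using ultra_le_imp_eq ultra_fsum assms q by metis
  moreover have "q \<le> E" using q(2) by (simp add: F_def)
  ultimately show ?thesis using q that by blast
qed

text \<open>
  The lemma of Ellis and Numakura: a nonempty closed semigroup of ultrafilters contains an idempotent.
\<close>

lemma idempotent_exists:
  assumes "F \<noteq> bot" and semi: "\<And>p q. ultra p \<Longrightarrow> ultra q \<Longrightarrow> p \<le> F \<Longrightarrow> q \<le> F \<Longrightarrow> fsum p q \<le> F"
  obtains p where "ultra p" "p \<le> F" "fsum p p = p"
proof -
  define \<Phi> where "\<Phi> G \<longleftrightarrow> (\<forall>p q. ultra p \<longrightarrow> ultra q \<longrightarrow> p \<le> G \<longrightarrow> q \<le> G \<longrightarrow> fsum p q \<le> G)" for G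
  have "\<exists>E\<le>F. E \<noteq> bot \<and> \<Phi> E \<and> (\<forall>G\<le>E. G \<noteq> bot \<longrightarrow> \<Phi> G \<longrightarrow> G = E)"
  proof (rule minimal_filter_exists[OF assms(1)])
    show "\<Phi> F" using semi by (simp add: \<Phi>_def)
    show "\<Phi> (Inf \<C>)" if "\<And>G. G \<in> \<C> \<Longrightarrow> \<Phi> G" for \<C>
      using that unfolding \<Phi>_def by (simp add: le_Inf_iff)
  qed
  then obtain E where E: "E \<le> F" "E \<noteq> bot" "\<Phi> E"
    and min: "\<And>G. G \<le> E \<Longrightarrow> G \<noteq> bot \<Longrightarrow> \<Phi> G \<Longrightarrow> G = E"
    by blast
  obtain p where p: "ultra p" "p \<le> E" using E(2) by (rule ultra_le_exists)
  have semiE: "fsum q r \<le> E" if "ultra q" "ultra r" "q \<le> E" "r \<le> E" for q r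
    using E(3) that by (simp add: \<Phi>_def)
  \<comment> \<open>By minimality right translation by \<open>p\<close> maps \<open>E\<close> onto itself.\<close>
  have "fsum E p = E"
  proof (rule min)
    show "fsum E p \<le> E"
      by (rule filter_le_via_ultra) (metis p semiE ultra_le_fsum)
    show "fsum E p \<noteq> bot"
      using E(2) ultra_neq_bot[OF p(1)] by (simp add: eventually_fsum flip: eventually_False)
    show "\<Phi> (fsum E p)"
      unfolding \<Phi>_def
    proof (intro allI impI)
      fix g h assume "ultra g" "ultra h" "g \<le> fsum E p" "h \<le> fsum E p"
      then obtain q r where "ultra q" "q \<le> E" "g = fsum q p" "ultra r" "r \<le> E" "h = fsum r p"
        using p(1) by (metis ultra_le_fsum)
      moreover from this have "fsum (fsum q p) r \<le> E"
        using p by (intro semiE ultra_fsum)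
      ultimately show "fsum g h \<le> fsum E p"
        by (metis fsum_assoc fsum_mono)
    qed
  qed
  then obtain q where q: "ultra q" "q \<le> E" "p = fsum q p"
    using p by (metis ultra_le_fsum)
  \<comment> \<open>Hence the stabiliser of \<open>p\<close> is a nonempty closed subsemigroup.\<close>
  define S where "S = inf E (INF P\<in>{P. eventually P p}. principal {n. \<forall>\<^sub>F m in p. P (n + m)})"
  have S: "r \<le> S \<longleftrightarrow> r \<le> E \<and> fsum r p \<le> p" for r
    by (simp add: S_def le_INF_iff le_principal le_filter_def[of "fsum r p"] eventually_fsum)
  have "S = E"
  proof (rule min)
    show "S \<le> E" by (simp add: S_def)
    have "q \<le> S" using q S by simp
    then show "S \<noteq> bot" using ultra_neq_bot[OF q(1)] bot_unique by blast
    show "\<Phi> S"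
      unfolding \<Phi>_def S
    proof (intro allI impI conjI; elim conjE)
      fix r s assume *: "ultra r" "ultra s" "r \<le> E" "s \<le> E" "fsum r p \<le> p" "fsum s p \<le> p"
      then show "fsum r s \<le> E" by (intro semiE)
      have "fsum s p = p" using * p by (metis ultra_fsum ultra_le_imp_eq)
      then show "fsum (fsum r s) p \<le> p" using *(5) by (simp add: fsum_assoc)
    qed
  qed
  then have "fsum p p \<le> p" using S p(2) by metis
  then have "fsum p p = p" using p(1) by (metis ultra_fsum ultra_le_imp_eq)
  then show ?thesis using that p E(1) by (meson order_trans)
qed

text \<open>
  An idempotent in a minimal closed shift-invariant set: each set in \<open>p\<close> is met with bounded gaps by the
  translates of \<open>p\<close>.
\<close>

lemma uniformly_recurrent_idempotent:
  obtains p where "ultra p" "p \<le> sequentially" "fsum p p = p"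
    and "\<And>W. eventually W p \<Longrightarrow> \<exists>K. \<forall>i. \<exists>k\<le>K. \<forall>\<^sub>F n in p. W (n + i + k)"
proof -
  have "\<exists>G\<le>sequentially. G \<noteq> bot \<and> filtermap Suc G \<le> G
      \<and> (\<forall>H\<le>G. H \<noteq> bot \<longrightarrow> filtermap Suc H \<le> H \<longrightarrow> H = G)"
  proof (rule minimal_filter_exists)
    show "filtermap Suc sequentially \<le> sequentially"
      by (rule filter_leI) (auto simp: eventually_filtermap eventually_sequentially le_SucI)
    show "filtermap Suc (Inf \<C>) \<le> Inf \<C>" if "\<And>H. H \<in> \<C> \<Longrightarrow> filtermap Suc H \<le> H" for \<C>
      using that by (meson Inf_greatest Inf_lower filtermap_mono order_trans)
  qed simp
  then obtain G where G: "G \<le> sequentially" "G \<noteq> bot" "filtermap Suc G \<le> G"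
    and min: "\<And>H. H \<le> G \<Longrightarrow> H \<noteq> bot \<Longrightarrow> filtermap Suc H \<le> H \<Longrightarrow> H = G"
    by blast
  have shift: "\<forall>\<^sub>F n in G. P (n + i)" if "eventually P G" for P i
  proof (induction i)
    case (Suc i)
    then have "\<forall>\<^sub>F n in filtermap Suc G. P (n + i)" using G(3) by (rule filter_leD[rotated])
    then show ?case by (simp add: eventually_filtermap)
  qed (use that in simp)
  obtain p where p: "ultra p" "p \<le> G" "fsum p p = p"
  proof (rule idempotent_exists[OF G(2)])
    fix q r assume "r \<le> G"
    show "fsum q r \<le> G"
    proof (rule filter_leI)
      fix P assume "eventually P G"
      then have "\<forall>\<^sub>F m in r. P (m + n)" for n
        using shift \<open>r \<le> G\<close> filter_leD by blast
      then show "eventually P (fsum q r)"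
        by (simp add: eventually_fsum add.commute)
    qed
  qed
  \<comment> \<open>If the gaps were unbounded, the shift-invariant set of limits avoiding \<open>W\<close> would be nonempty.\<close>
  have "\<exists>K. \<forall>i. \<exists>k\<le>K. \<forall>\<^sub>F n in p. W (n + i + k)" if W: "eventually W p" for W
  proof -
    have "\<exists>K. \<forall>\<^sub>F n in G. \<exists>k\<le>K. W (n + k)"
    proof (rule ccontr)
      assume no: "\<nexists>K. \<forall>\<^sub>F n in G. \<exists>k\<le>K. W (n + k)"
      define H where "H = (INF K. inf G (principal {n. \<forall>k\<le>K. \<not> W (n + k)}))"
      have ev: "eventually P H \<longleftrightarrow> (\<exists>K. \<forall>\<^sub>F n in G. (\<forall>k\<le>K. \<not> W (n + k)) \<longrightarrow> P n)" for P
        unfolding H_def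
      proof (subst eventually_INF_base)
        fix a b :: nat
        show "\<exists>x\<in>UNIV. inf G (principal {n. \<forall>k\<le>x. \<not> W (n + k)})
          \<le> inf (inf G (principal {n. \<forall>k\<le>a. \<not> W (n + k)})) (inf G (principal {n. \<forall>k\<le>b. \<not> W (n + k)}))"
          by (rule bexI[of _ "max a b"]) (auto intro!: le_infI le_infI2)
      qed (auto simp: eventually_inf_principal)
      have "H = G"
      proof (rule min)
        show "H \<le> G" unfolding H_def by (rule INF_lower2[of 0]) auto
        show "H \<noteq> bot"
          using no ev[of "\<lambda>_. False"] by (auto simp flip: eventually_False)
        show "filtermap Suc H \<le> H"
        proof (rule filter_leI)
          fix P assume "eventually P H"
          then obtain K where K: "\<forall>\<^sub>F n in G. (\<forall>k\<le>K. \<not> W (n + k)) \<longrightarrow> P n"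
            unfolding ev by blast
          have "\<forall>\<^sub>F n in G. (\<forall>k\<le>Suc K. \<not> W (n + k)) \<longrightarrow> P (Suc n)"
            using shift[OF K, of 1] by eventually_elim (metis Suc_eq_plus1 Suc_le_mono add_Suc_shift)
          then show "eventually P (filtermap Suc H)"
            unfolding eventually_filtermap ev by blast
        qed
      qed
      moreover have "\<forall>\<^sub>F n in H. \<not> W n"
        unfolding ev by (rule exI[of _ 0]) simp
      ultimately have "\<forall>\<^sub>F n in p. \<not> W n" using p(2) by (simp add: filter_leD)
      then show False using W ultra_not_eventually[OF p(1)] by blast
    qed
    then obtain K where K: "\<forall>\<^sub>F n in G. \<exists>k\<in>{..K}. W (n + k)" by (auto simp: Bex_def)
    have "\<exists>k\<le>K. \<forall>\<^sub>F n in p. W (n + i + k)" for i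
      using ultra_eventually_bex[OF p(1) finite_atMost filter_leD[OF p(2) shift[OF K, of i]]]
      by (auto simp: Bex_def)
    then show ?thesis by blast
  qed
  then show ?thesis using that p G(1) by (meson order_trans)
qed


section \<open>Sets related by doubling\<close>

text \<open>
  The limits of \<open>A\<close> at \<open>p + p + j\<close> and of \<open>B\<close> at \<open>2 * p + j\<close> agree. Nonnegative shifts \<open>j\<close> suffice, since \<open>p\<close> can
  be shifted as well.
\<close>

definition doubles :: "(nat \<Rightarrow> bool) \<Rightarrow> (nat \<Rightarrow> bool) \<Rightarrow> bool" where
  "doubles A B \<longleftrightarrow> (\<forall>p j. ultra p \<longrightarrow> p \<le> sequentially \<longrightarrow>
     (\<forall>\<^sub>F n in p. \<forall>\<^sub>F m in p. A (n + m + j)) = (\<forall>\<^sub>F n in p. B (2 * n + j)))"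

lemma doublesD:
  assumes "doubles A B" "ultra p" "p \<le> sequentially"
  shows "(\<forall>\<^sub>F n in p. \<forall>\<^sub>F m in p. A (n + m + j)) \<longleftrightarrow> (\<forall>\<^sub>F n in p. B (2 * n + j))"
  using assms by (simp add: doubles_def)

lemma doubles_not:
  assumes "doubles A B"
  shows "doubles (\<lambda>n. \<not> A n) (\<lambda>n. \<not> B n)"
  unfolding doubles_def
proof (intro allI impI)
  fix p :: "nat filter" and j assume p: "ultra p" "p \<le> sequentially"
  show "(\<forall>\<^sub>F n in p. \<forall>\<^sub>F m in p. \<not> A (n + m + j)) = (\<forall>\<^sub>F n in p. \<not> B (2 * n + j))"
    using doublesD[OF assms p, of j] by (simp flip: ultra_not_eventually[OF p(1)])
qed

lemma doubles_runs:
  assumes "doubles A B"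
  shows "doubles (\<lambda>n. \<forall>i\<le>h. A (n + i)) (\<lambda>n. \<forall>i\<le>h. B (n + i))"
  unfolding doubles_def
proof (intro allI impI)
  fix p :: "nat filter" and j assume p: "ultra p" "p \<le> sequentially"
  have "(\<forall>\<^sub>F n in p. \<forall>\<^sub>F m in p. \<forall>i\<in>{..h}. A (n + m + (j + i))) \<longleftrightarrow> (\<forall>\<^sub>F n in p. \<forall>i\<in>{..h}. B (2 * n + (j + i)))"
    by (simp only: eventually_ball_finite_distrib[OF finite_atMost] doublesD[OF assms p])
  then show "(\<forall>\<^sub>F n in p. \<forall>\<^sub>F m in p. \<forall>i\<le>h. A (n + m + j + i)) = (\<forall>\<^sub>F n in p. \<forall>i\<le>h. B (2 * n + j + i))"
    by (simp add: Ball_def add.assoc)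
qed

text \<open>
  Membership in \<open>A\<close> to the right of \<open>p\<close> alone determines \<open>B\<close> at \<open>2 * p\<close>, because \<open>p + p\<close> is a limit of
  translates of \<open>p\<close> by large positive numbers.
\<close>

lemma doubles_long_run:
  assumes "doubles A B"
  obtains M where "\<And>n k. n \<ge> M \<Longrightarrow> \<forall>i\<le>M. A (n + i) \<Longrightarrow> k \<le> 1 \<Longrightarrow> B (2 * n + k)"
proof (rule ccontr)
  assume "\<not> thesis"
  then have ex: "\<exists>n\<ge>M. (\<forall>i\<le>M. A (n + i)) \<and> (\<exists>k\<in>{..1}. \<not> B (2 * n + k))" for M
    using that by (meson atMost_iff)
  obtain p where p: "ultra p" "p \<le> sequentially"
    and ev: "\<And>M. \<forall>\<^sub>F n in p. (\<forall>i\<le>M. A (n + i)) \<and> (\<exists>k\<in>{..1}. \<not> B (2 * n + k))"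
    by (rule ultra_sequence[of "\<lambda>M n. (\<forall>i\<le>M. A (n + i)) \<and> (\<exists>k\<in>{..1}. \<not> B (2 * n + k))"])
       (use ex in auto)
  have "\<forall>\<^sub>F n in p. \<exists>k\<in>{..1}. \<not> B (2 * n + k)"
    using ev[of 0] by eventually_elim blast
  then obtain k where k: "\<forall>\<^sub>F n in p. \<not> B (2 * n + k)"
    using ultra_eventually_bex[OF p(1) finite_atMost, of "1::nat" "\<lambda>k n. \<not> B (2 * n + k)"] by blast
  have "\<forall>\<^sub>F m in p. A (n + m + k)" for n
    using ev[of "n + k"] by eventually_elim (metis add.assoc add.commute order_refl)
  then have "\<forall>\<^sub>F n in p. B (2 * n + k)"
    by (simp flip: doublesD[OF assms p])
  with k show False using ultra_not_eventually[OF p(1)] by blast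
qed

text \<open>
  The core of the continuity argument. Here \<open>a\<close> and \<open>b\<close> are the starting points of long intervals inside
  two disjoint sets. Starting points double to starting points of the other kind, with some room to the
  right, and long gaps double to gaps.
\<close>

lemma no_doubling_run_starts:
  fixes a b :: "nat \<Rightarrow> bool"
  assumes disj: "\<And>n. \<not> (a n \<and> b n)"
    and ba: "doubles b a"
    and up: "\<And>n k. n \<ge> M \<Longrightarrow> k \<le> 2 \<Longrightarrow> a n \<Longrightarrow> b (2 * n + k)"
            "\<And>n k. n \<ge> M \<Longrightarrow> k \<le> 2 \<Longrightarrow> b n \<Longrightarrow> a (2 * n + k)"
    and gap: "\<And>n k. n \<ge> M \<Longrightarrow> k \<le> 1 \<Longrightarrow> \<forall>i\<le>M. \<not> a (n + i) \<Longrightarrow> \<not> b (2 * n + k)"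
             "\<And>n k. n \<ge> M \<Longrightarrow> k \<le> 1 \<Longrightarrow> \<forall>i\<le>M. \<not> b (n + i) \<Longrightarrow> \<not> a (2 * n + k)"
    and s: "s \<ge> M" "a s"
  shows False
proof -
  \<comment> \<open>At scale \<open>2 ^ k\<close>, the kind found at \<open>2 ^ k * s\<close> and the opposite one; they alternate with \<open>k\<close>.\<close>
  define own where "own k n = (if even k then a n else b n)" for k :: nat and n
  define opp where "opp k n = (if even k then b n else a n)" for k :: nat and n
  define r where "r k = (LEAST n. 2 ^ k * s \<le> n \<and> opp k n)" for k
  have opp_Suc: "opp (Suc k) = own k" "own (Suc k) = opp k" for k
    by (auto simp: own_def opp_def)
  have disj': "\<not> (own k n \<and> opp k n)" for k n
    using disj by (auto simp: own_def opp_def)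
  have up': "own (Suc k) (2 * n + i)" if "own k n" "n \<ge> M" "i \<le> 2" for k n i
    using that up by (auto simp: own_def)
  have up'': "opp (Suc k) (2 * n + i)" if "opp k n" "n \<ge> M" "i \<le> 2" for k n i
    using that up by (auto simp: opp_def)
  have gap': "\<not> opp (Suc k) (2 * n + i)" if "\<forall>j\<le>M. \<not> opp k (n + j)" "n \<ge> M" "i \<le> 1" for k n i
    using that gap by (cases "even k") (simp_all add: opp_def)
  have Mk: "M \<le> 2 ^ k * s" for k
    using s(1) by (metis le_trans mult_le_mono1 nat_mult_1 one_le_numeral one_le_power)
  have own_block: "own k n" if "2 ^ k * s \<le> n" "n < 2 ^ k * Suc s" for k n
    using that
  proof (induction k arbitrary: n)
    case 0
    then have "n = s" by simp
    then show ?case using s(2) by (simp add: own_def)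
  next
    case (Suc k)
    have "2 ^ k * s \<le> n div 2" "n div 2 < 2 ^ k * Suc s"
      using Suc.prems by auto
    then have "own (Suc k) (2 * (n div 2) + n mod 2)"
      using Suc.IH Mk[of k] by (intro up') auto
    then show ?case by simp
  qed
  have "opp k (2 ^ Suc k * s)" for k
    using own_block[of "Suc k" "2 ^ Suc k * s"] opp_Suc by simp
  then have "\<exists>n. 2 ^ k * s \<le> n \<and> opp k n" for k
    by (intro exI[of _ "2 ^ Suc k * s"]) simp
  then have r: "2 ^ k * s \<le> r k" "opp k (r k)" for k
    using LeastI_ex[of "\<lambda>n. 2 ^ k * s \<le> n \<and> opp k n"] by (auto simp: r_def)
  have before_r: "\<not> opp k n" if "2 ^ k * s \<le> n" "n < r k" for k n
    using not_less_Least[of n "\<lambda>n. 2 ^ k * s \<le> n \<and> opp k n"] that by (auto simp: r_def)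
  have r_lower: "2 ^ k * s + 2 ^ k \<le> r k" for k
    using own_block[of k "r k"] r[of k] disj'[of k "r k"] by (force simp: not_less)
  have r_upper: "r (Suc k) \<le> 2 * r k" for k
  proof -
    have "opp (Suc k) (2 * r k)"
      using up''[of k "r k" 0] r[of k] Mk[of k] by simp
    then show ?thesis
      using before_r[of "Suc k" "2 * r k"] r(1)[of k] by (force simp: not_less)
  qed
  have r_double: "2 * r k \<le> r (Suc k) + 2 * M" for k
  proof -
    let ?n = "r (Suc k) div 2"
    have n: "2 ^ k * s \<le> ?n" using r(1)[of "Suc k"] by simp
    have "opp (Suc k) (2 * ?n + r (Suc k) mod 2)" using r(2) by simp
    then obtain j where "j \<le> M" "opp k (?n + j)"
      using gap'[of k ?n "r (Suc k) mod 2"] n Mk[of k] by fastforce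
    then have "r k \<le> ?n + M"
      using before_r[of k "?n + j"] n by (force simp: not_less)
    then show ?thesis by simp
  qed
  \<comment> \<open>Pass to a limit \<open>p\<close> of the numbers \<open>r k - e\<close> with \<open>k\<close> even. The offset \<open>e\<close> keeps the shifts below
      nonnegative; \<open>j\<close> is the resulting position of \<open>r (Suc k)\<close> relative to \<open>2 * p\<close>.\<close>
  define I where "I = M + 1"
  define e where "e = 2 * M + I"
  define P where "P n j \<longleftrightarrow> a (2 * n + j) \<and> (\<forall>i\<in>{1..I}. \<not> a (2 * n + (j - i)))" for n j
  have "\<exists>n\<ge>N. b (n + e) \<and> (\<exists>j\<in>{2 * e - 2 * M..2 * e}. P n j)" for N
  proof -
    define k where "k = 2 * (N + e + I)"
    define n where "n = r k - e"
    have k: "even k" by (simp add: k_def)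
    have "N + e + I \<le> k" by (simp add: k_def)
    then have "N + e + I < 2 ^ k" using less_exp[of k] by (rule le_less_trans)
    then have "N + e + I \<le> r k" "2 ^ Suc k * s + I \<le> r (Suc k)"
      using r_lower[of k] r_lower[of "Suc k"] by simp_all
    then have n: "r k = n + e" "n \<ge> N" by (auto simp: n_def)
    define j where "j = r (Suc k) - 2 * n"
    have j: "r (Suc k) = 2 * n + j" "j \<in> {2 * e - 2 * M..2 * e}"
      using r_upper[of k] r_double[of k] n by (auto simp: j_def e_def)
    have "b (n + e)" using r(2)[of k] k n by (simp add: opp_def)
    moreover have "P n j"
      unfolding P_def
    proof (intro conjI ballI)
      show "a (2 * n + j)" using r(2)[of "Suc k"] k j(1) by (simp add: opp_def)
      fix i assume i: "i \<in> {1..I}"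
      have "I \<le> j" using j(2) by (auto simp: e_def)
      then have "2 ^ Suc k * s \<le> 2 * n + (j - i)" "2 * n + (j - i) < r (Suc k)"
        using i j(1) \<open>2 ^ Suc k * s + I \<le> r (Suc k)\<close>
        unfolding atLeastAtMost_iff by linarith+
      then show "\<not> a (2 * n + (j - i))"
        using before_r[of "Suc k" "2 * n + (j - i)"] k by (simp add: opp_def)
    qed
    ultimately show ?thesis using n(2) j(2) by blast
  qed
  then obtain p where p: "ultra p" "p \<le> sequentially"
    and ev: "\<forall>\<^sub>F n in p. b (n + e) \<and> (\<exists>j\<in>{2 * e - 2 * M..2 * e}. P n j)"
    by (rule ultra_sequence[of "\<lambda>_ n. b (n + e) \<and> (\<exists>j\<in>{2 * e - 2 * M..2 * e}. P n j)"]) auto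
  have "\<forall>\<^sub>F n in p. \<exists>j\<in>{2 * e - 2 * M..2 * e}. P n j"
    using ev by eventually_elim blast
  then obtain j where j: "j \<in> {2 * e - 2 * M..2 * e}" "\<forall>\<^sub>F n in p. P n j"
    using ultra_eventually_bex[OF p(1), of "{2 * e - 2 * M..2 * e}" "\<lambda>j n. P n j"] by blast
  have jI: "I \<le> j" using j(1) by (auto simp: e_def)
  \<comment> \<open>By doubling, \<open>p + p + j\<close> is in \<open>b\<close>, after a gap of length \<open>I\<close>.\<close>
  have b1: "\<forall>\<^sub>F n in p. \<forall>\<^sub>F m in p. b (n + m + j)"
    unfolding doublesD[OF ba p] using j(2) by eventually_elim (simp add: P_def)
  have "\<forall>i\<in>{1..I}. \<forall>\<^sub>F n in p. \<forall>\<^sub>F m in p. \<not> b (n + m + (j - i))"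
    unfolding doublesD[OF doubles_not[OF ba] p]
    using j(2) by (auto simp: P_def elim: eventually_mono)
  then have b2: "\<forall>\<^sub>F n in p. \<forall>\<^sub>F m in p. \<forall>i\<in>{1..I}. \<not> b (n + m + (j - i))"
    by (simp add: eventually_ball_finite_distrib)
  have "\<forall>\<^sub>F n in p. e + I \<le> n \<and> (\<forall>\<^sub>F m in p. b (n + m + j)) \<and> (\<forall>\<^sub>F m in p. \<forall>i\<in>{1..I}. \<not> b (n + m + (j - i)))"
    by (intro eventually_conj b1 b2 eventually_ge_nonprincipal[OF p(2)])
  then obtain n where n: "e + I \<le> n" "\<forall>\<^sub>F m in p. b (n + m + j)"
      "\<forall>\<^sub>F m in p. \<forall>i\<in>{1..I}. \<not> b (n + m + (j - i))"
    using eventually_happens' ultra_neq_bot[OF p(1)] by blast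
  have "\<forall>\<^sub>F m in p. b (m + e)" using ev by eventually_elim blast
  then have "\<forall>\<^sub>F m in p. M \<le> m \<and> b (m + e) \<and> b (n + m + j) \<and> (\<forall>i\<in>{1..I}. \<not> b (n + m + (j - i)))"
    by (intro eventually_conj n eventually_ge_nonprincipal[OF p(2)])
  then obtain m where m: "M \<le> m" "b (m + e)" "\<forall>i\<in>{1..I}. \<not> b (n + m + (j - i))"
    using eventually_happens' ultra_neq_bot[OF p(1)] by blast
  \<comment> \<open>Since \<open>m + e\<close> is in \<open>b\<close>, there is a last element \<open>x\<close> of \<open>b\<close> before that gap. Doubling \<open>x\<close> itself gives
      \<open>2 * x + 2\<close> in \<open>a\<close>, doubling the gap excludes it.\<close>
  define X where "X = {x. m + e \<le> x \<and> x + I < n + m + j \<and> b x}"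
  have "finite X" by (rule finite_subset[of _ "{..n + m + j}"]) (auto simp: X_def)
  moreover have "m + e \<in> X" using m n(1) jI by (auto simp: X_def I_def)
  ultimately have x: "Max X \<in> X" and max: "\<And>y. y \<in> X \<Longrightarrow> y \<le> Max X"
    by (auto intro: Max_in)
  define x where "x = Max X"
  have "\<forall>i\<le>M. \<not> b (x + 1 + i)"
  proof (intro allI impI notI)
    fix i assume i: "i \<le> M" and b: "b (x + 1 + i)"
    show False
    proof (cases "x + 1 + i + I < n + m + j")
      case True
      then have "x + 1 + i \<in> X" using b x by (auto simp: X_def x_def)
      then show False using max by (fastforce simp: x_def)
    next
      case False
      define d where "d = n + m + j - (x + 1 + i)"
      have "x + I < n + m + j" using x by (simp add: X_def x_def)
      then have "d \<in> {1..I}" "x + 1 + i = n + m + (j - d)"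
        using False i jI by (auto simp: d_def I_def)
      then show False using m(3) b by metis
    qed
  qed
  moreover have "M \<le> x" "b x" using x m(1) by (auto simp: X_def x_def)
  ultimately show False
    using gap(2)[of "x + 1" 0] up(2)[of x 2] by simp
qed

text \<open>
  If doubling interchanges two disjoint sets in the limit, their intervals have bounded length.
\<close>

theorem no_doubling_runs:
  assumes disj: "\<And>n. \<not> (A n \<and> B n)"
    and AB: "doubles A B" and BA: "doubles B A"
  shows "\<exists>h N. \<forall>n\<ge>N. \<exists>i\<le>h. \<not> A (n + i)"
proof (rule ccontr)
  assume "\<not> ?thesis"
  then have long: "\<exists>n\<ge>N. \<forall>i\<le>h. A (n + i)" for h N by auto
  obtain M1 where M1: "\<And>n k. n \<ge> M1 \<Longrightarrow> \<forall>i\<le>M1. A (n + i) \<Longrightarrow> k \<le> 1 \<Longrightarrow> B (2 * n + k)"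
    using doubles_long_run[OF AB] by metis
  obtain M2 where M2: "\<And>n k. n \<ge> M2 \<Longrightarrow> \<forall>i\<le>M2. B (n + i) \<Longrightarrow> k \<le> 1 \<Longrightarrow> A (2 * n + k)"
    using doubles_long_run[OF BA] by metis
  define M where "M = max M1 M2"
  \<comment> \<open>An interval of length \<open>h\<close> doubles to one of length at least \<open>2 * (h - M) + 1\<close>, which is \<open>h + 2\<close>.\<close>
  define h where "h = 2 * M + 1"
  define a where "a n \<longleftrightarrow> (\<forall>i\<le>h. A (n + i))" for n
  define b where "b n \<longleftrightarrow> (\<forall>i\<le>h. B (n + i))" for n
  have up: "\<forall>i\<le>h. D (2 * n + k + i)"
    if "\<forall>i\<le>h. C (n + i)" "n \<ge> M" "k \<le> 2"
      and step: "\<And>n k. n \<ge> M \<Longrightarrow> \<forall>i\<le>M. C (n + i) \<Longrightarrow> k \<le> 1 \<Longrightarrow> D (2 * n + k)"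
    for C D :: "nat \<Rightarrow> bool" and n k
  proof (intro allI impI)
    fix i assume i: "i \<le> h"
    define l where "l = (k + i) div 2"
    have "l + M \<le> h" using i that(3) by (auto simp: h_def l_def)
    then have "\<forall>i\<le>M. C (n + l + i)" using that(1) by (simp add: add.assoc)
    then have "D (2 * (n + l) + (k + i) mod 2)" using that(2) by (intro step) auto
    moreover have "2 * (n + l) + (k + i) mod 2 = 2 * n + k + i" by (simp add: l_def algebra_simps)
    ultimately show "D (2 * n + k + i)" by metis
  qed
  have ab: "doubles a b" and ba: "doubles b a"
    unfolding a_def b_def using AB BA by (simp_all add: doubles_runs)
  obtain N1 where N1: "\<And>n k. n \<ge> N1 \<Longrightarrow> \<forall>i\<le>N1. \<not> a (n + i) \<Longrightarrow> k \<le> 1 \<Longrightarrow> \<not> b (2 * n + k)"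
    using doubles_long_run[OF doubles_not[OF ab]] by metis
  obtain N2 where N2: "\<And>n k. n \<ge> N2 \<Longrightarrow> \<forall>i\<le>N2. \<not> b (n + i) \<Longrightarrow> k \<le> 1 \<Longrightarrow> \<not> a (2 * n + k)"
    using doubles_long_run[OF doubles_not[OF ba]] by metis
  define L where "L = max M (max N1 N2)"
  obtain s where s: "s \<ge> L" "a s" using long unfolding a_def by blast
  show False
  proof (rule no_doubling_run_starts[of a b L s])
    show "\<not> (a n \<and> b n)" for n using disj by (auto simp: a_def b_def)
    show "b (2 * n + k)" if "L \<le> n" "k \<le> 2" "a n" for n k
      unfolding b_def using that(3) unfolding a_def
      by (rule up) (use that M1 in \<open>auto simp: L_def M_def\<close>)
    show "a (2 * n + k)" if "L \<le> n" "k \<le> 2" "b n" for n k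
      unfolding a_def using that(3) unfolding b_def
      by (rule up) (use that M2 in \<open>auto simp: L_def M_def\<close>)
    show "\<not> b (2 * n + k)" if "L \<le> n" "k \<le> 1" "\<forall>i\<le>L. \<not> a (n + i)" for n k
      using that by (intro N1) (auto simp: L_def)
    show "\<not> a (2 * n + k)" if "L \<le> n" "k \<le> 1" "\<forall>i\<le>L. \<not> b (n + i)" for n k
      using that by (intro N2) (auto simp: L_def)
  qed (fact ba s)+
qed


section \<open>Colourings without monochromatic sumsets\<close>

text \<open>
  When the limits of \<open>c\<close> at \<open>p + p + j\<close> and \<open>2 * p + j\<close> agree for some \<open>p\<close> and \<open>j\<close>, a suitable infinite set
  can be chosen greedily among the numbers typical for \<open>p\<close>.
\<close>

lemma not_doubles_imp_sumset:
  assumes "\<not> doubles c (\<lambda>n. \<not> c n)"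
  obtains j v S where "infinite S" "\<And>n m. n \<in> S \<Longrightarrow> m \<in> S \<Longrightarrow> c (n + m + j) = v"
proof -
  obtain p j where p: "ultra p" "p \<le> sequentially"
    and eq: "(\<forall>\<^sub>F n in p. \<forall>\<^sub>F m in p. c (n + m + j)) = (\<forall>\<^sub>F n in p. c (2 * n + j))"
    using assms unfolding doubles_def by (metis ultra_not_eventually)
  define v where "v = (\<forall>\<^sub>F n in p. c (2 * n + j))"
  define G where "G n \<longleftrightarrow> c (2 * n + j) = v \<and> (\<forall>\<^sub>F m in p. c (n + m + j) = v)" for n
  have G: "\<forall>\<^sub>F n in p. G n"
    unfolding G_def
  proof (rule eventually_conj)
    show "\<forall>\<^sub>F n in p. c (2 * n + j) = v"
      unfolding v_def by (rule ultra_eventually_eq[OF p(1)])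
    have "\<forall>\<^sub>F n in p. (\<forall>\<^sub>F m in p. c (n + m + j)) = v"
      unfolding v_def eq[symmetric] by (rule ultra_eventually_eq[OF p(1)])
    then show "\<forall>\<^sub>F n in p. \<forall>\<^sub>F m in p. c (n + m + j) = v"
    proof eventually_elim
      case (elim n)
      then show ?case
        using ultra_eventually_eq[OF p(1), of "\<lambda>m. c (n + m + j)"] by (simp only:)
    qed
  qed
  define good where "good k T \<longleftrightarrow> finite T \<and> card T = k \<and> (\<forall>n\<in>T. G n) \<and> (\<forall>n\<in>T. \<forall>m\<in>T. c (n + m + j) = v)"
    for k and T :: "nat set"
  have "\<exists>f. \<forall>k. good k (f k) \<and> f k \<subseteq> f (Suc k)"
  proof (rule dependent_nat_choice)
    show "\<exists>T. good 0 T" by (rule exI[of _ "{}"]) (simp add: good_def)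
  next
    fix T k assume T: "good k T"
    then have "\<forall>\<^sub>F m in p. \<forall>n\<in>T. Suc n \<le> m"
      by (intro eventually_ball_finite ballI eventually_ge_nonprincipal[OF p(2)]) (simp add: good_def)
    moreover have "\<forall>\<^sub>F m in p. \<forall>n\<in>T. c (n + m + j) = v"
      using T by (simp add: good_def G_def eventually_ball_finite_distrib)
    ultimately have "\<forall>\<^sub>F m in p. (\<forall>n\<in>T. Suc n \<le> m) \<and> G m \<and> (\<forall>n\<in>T. c (n + m + j) = v)"
      using G by eventually_elim blast
    then obtain m where m: "\<forall>n\<in>T. Suc n \<le> m" "G m" "\<forall>n\<in>T. c (n + m + j) = v"
      using eventually_happens' ultra_neq_bot[OF p(1)] by blast
    have "m \<notin> T" using m(1) by auto
    then have "good (Suc k) (insert m T)"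
      using T m by (auto simp: good_def G_def add.commute mult_2)
    then show "\<exists>T'. good (Suc k) T' \<and> T \<subseteq> T'" by blast
  qed
  then obtain f where f: "\<And>k. good k (f k)" "\<And>k. f k \<subseteq> f (Suc k)" by blast
  define S where "S = (\<Union>k. f k)"
  have mono: "f a \<subseteq> f b" if "a \<le> b" for a b
    using lift_Suc_mono_le[of f a b] f(2) that by blast
  show ?thesis
  proof (rule that[of S j v])
    show "infinite S"
    proof
      assume "finite S"
      then have "card (f (Suc (card S))) \<le> card S" by (rule card_mono) (auto simp: S_def)
      then show False using f(1)[of "Suc (card S)"] by (simp add: good_def)
    qed
    fix n m assume "n \<in> S" "m \<in> S"
    then obtain a b where "n \<in> f a" "m \<in> f b" by (auto simp: S_def)
    then have "n \<in> f (max a b)" "m \<in> f (max a b)"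
      using mono[of a "max a b"] mono[of b "max a b"] by auto
    then show "c (n + m + j) = v" using f(1)[of "max a b"] by (simp add: good_def)
  qed
qed

text \<open>
  For a fixed sequence \<open>x\<close>, agreement of \<open>c\<close> with \<open>x\<close> (for \<open>\<sigma>\<close> true) or with its complement (for \<open>\<sigma>\<close> false)
  on a long enough block at \<open>n\<close> determines \<open>c (2 * n)\<close>: in a limit \<open>p\<close> of counterexamples, \<open>c\<close> at \<open>p + p\<close>
  would be the limit of \<open>x\<close> or its complement along \<open>p\<close>, hence equal to \<open>c\<close> at \<open>2 * p\<close>.
\<close>

lemma doubles_compactness:
  fixes c x :: "nat \<Rightarrow> bool"
  assumes c: "doubles c (\<lambda>n. \<not> c n)"
  obtains L where "\<And>n \<sigma>. n \<ge> L \<Longrightarrow> \<forall>j\<le>L. c (n + j) = (x j = \<sigma>) \<Longrightarrow> c (2 * n) \<noteq> (x n = \<sigma>)"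
proof (rule ccontr)
  define Q where "Q M n \<sigma> \<longleftrightarrow> (\<forall>j\<le>M. c (n + j) = (x j = \<sigma>)) \<and> c (2 * n) = (x n = \<sigma>)"
    for M n and \<sigma> :: bool
  assume "\<not> thesis"
  then have ex: "\<exists>n\<ge>M. \<exists>\<sigma>\<in>UNIV. Q M n \<sigma>" for M
    using that by (metis Q_def UNIV_I)
  obtain p where p: "ultra p" "p \<le> sequentially"
    and ev: "\<And>M. \<forall>\<^sub>F n in p. \<exists>\<sigma>\<in>UNIV. Q M n \<sigma>"
    by (rule ultra_sequence[of "\<lambda>M n. \<exists>\<sigma>\<in>UNIV. Q M n \<sigma>"]) (use ex in \<open>auto simp: Q_def\<close>)
  have "\<exists>\<sigma>. \<forall>\<^sub>F n in p. Q M n \<sigma>" for M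
    using ultra_eventually_bex[OF p(1) _ ev[of M]] by auto
  then obtain \<sigma> where \<sigma>: "\<And>M. \<forall>\<^sub>F n in p. Q M n (\<sigma> M)" by metis
  \<comment> \<open>The value \<open>\<sigma>\<close> is determined by \<open>c n = (x 0 = \<sigma>)\<close>, so it does not depend on \<open>M\<close>.\<close>
  have \<sigma>0: "\<forall>\<^sub>F n in p. Q M n (\<sigma> 0)" for M
  proof -
    have "\<forall>\<^sub>F n in p. Q 0 n (\<sigma> 0) \<and> Q M n (\<sigma> M)" by (intro eventually_conj \<sigma>)
    then have "\<exists>n. Q 0 n (\<sigma> 0) \<and> Q M n (\<sigma> M)"
      using eventually_happens' ultra_neq_bot[OF p(1)] by blast
    then have "\<sigma> 0 = \<sigma> M" by (auto simp: Q_def)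
    then show ?thesis using \<sigma>[of M] by simp
  qed
  have "(\<forall>\<^sub>F m in p. c (m + n)) = (x n = \<sigma> 0)" for n
    by (rule ultra_eventually_iff[OF p(1)], rule eventually_mono[OF \<sigma>0[of n]]) (auto simp: Q_def)
  then have "(\<forall>\<^sub>F n in p. \<forall>\<^sub>F m in p. c (n + m + 0)) = (\<forall>\<^sub>F n in p. x n = \<sigma> 0)"
    by (simp add: add.commute)
  also have "\<dots> = (\<forall>\<^sub>F n in p. c (2 * n))"
    by (rule eventually_cong[OF \<sigma>0[of 0]]) (auto simp: Q_def)
  finally show False
    unfolding doublesD[OF c p] using ultra_not_eventually[OF p(1)] by auto
qed

text \<open>
  Complementation under doubling passes from \<open>c\<close> to all conditions that depend on finitely many values
  of \<open>c\<close> and of \<open>\<lambda>n. c (2 * n)\<close>. For the latter, the hypothesis is applied to the ultrafilter \<open>2 * p\<close>.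
\<close>

lemma doubles_window:
  fixes c :: "nat \<Rightarrow> bool"
  assumes c: "doubles c (\<lambda>n. \<not> c n)"
    and local: "\<And>f g f' g'. (\<forall>i\<le>N. f i = f' i) \<Longrightarrow> (\<forall>i\<le>N. g i = g' i) \<Longrightarrow> \<Phi> f g = \<Phi> f' g'"
    and neg: "\<And>f g. \<Psi> (\<lambda>i. \<not> f i) (\<lambda>i. \<not> g i) = \<Phi> f g"
  shows "doubles (\<lambda>n. \<Phi> (\<lambda>i. c (n + i)) (\<lambda>i. c (2 * (n + i))))
                 (\<lambda>n. \<Psi> (\<lambda>i. c (n + i)) (\<lambda>i. c (2 * (n + i))))"
  unfolding doubles_def
proof (intro allI impI)
  fix p :: "nat filter" and j assume p: "ultra p" "p \<le> sequentially"
  define f where "f i \<longleftrightarrow> (\<forall>\<^sub>F n in p. \<forall>\<^sub>F m in p. c (n + m + (j + i)))" for i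
  define g where "g i \<longleftrightarrow> (\<forall>\<^sub>F n in p. \<forall>\<^sub>F m in p. c (2 * (n + m + (j + i))))" for i
  have sum: "\<forall>\<^sub>F n in p. \<forall>\<^sub>F m in p. P (n + m) = (\<forall>\<^sub>F n in p. \<forall>\<^sub>F m in p. P (n + m))" for P :: "nat \<Rightarrow> bool"
    using ultra_eventually_eq[OF ultra_fsum[OF p(1) p(1)], of P] by (simp add: eventually_fsum)
  have f1: "\<forall>\<^sub>F n in p. \<forall>\<^sub>F m in p. c (n + m + (j + i)) = f i" for i
    unfolding f_def by (rule sum[of "\<lambda>l. c (l + (j + i))"])
  have g1: "\<forall>\<^sub>F n in p. \<forall>\<^sub>F m in p. c (2 * (n + m + (j + i))) = g i" for i
    unfolding g_def by (rule sum[of "\<lambda>l. c (2 * (l + (j + i)))"])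
  define p2 where "p2 = filtermap (\<lambda>n. 2 * n) p"
  have p2: "ultra p2" "p2 \<le> sequentially"
  proof -
    show "ultra p2" unfolding p2_def using p(1) by (rule ultra_filtermap)
    have "\<forall>\<^sub>F n in p2. k \<le> n" for k
      unfolding p2_def eventually_filtermap
      using eventually_ge_nonprincipal[OF p(2), of k] by eventually_elim simp
    then show "p2 \<le> sequentially"
      by (auto simp: at_top_def le_INF_iff le_principal)
  qed
  have f2: "\<forall>\<^sub>F n in p. c (2 * n + (j + i)) = (\<not> f i)" for i
  proof -
    have "(\<forall>\<^sub>F n in p. c (2 * n + (j + i))) = (\<not> f i)"
      unfolding f_def doublesD[OF c p] ultra_not_eventually[OF p(1), symmetric] by blast
    then show ?thesis
      using ultra_eventually_eq[OF p(1), of "\<lambda>n. c (2 * n + (j + i))"] by (simp only:)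
  qed
  have g2: "\<forall>\<^sub>F n in p. c (2 * (2 * n + (j + i))) = (\<not> g i)" for i
  proof -
    have "g i = (\<forall>\<^sub>F n in p2. \<forall>\<^sub>F m in p2. c (n + m + 2 * (j + i)))"
      by (simp add: g_def p2_def eventually_filtermap algebra_simps)
    also have "\<dots> = (\<forall>\<^sub>F n in p. \<not> c (2 * (2 * n + (j + i))))"
      unfolding doublesD[OF c p2] by (simp add: p2_def eventually_filtermap algebra_simps)
    finally have "(\<forall>\<^sub>F n in p. c (2 * (2 * n + (j + i)))) = (\<not> g i)"
      unfolding ultra_not_eventually[OF p(1), symmetric] by blast
    then show ?thesis
      using ultra_eventually_eq[OF p(1), of "\<lambda>n. c (2 * (2 * n + (j + i)))"] by (simp only:)
  qed
  have "\<forall>\<^sub>F n in p. \<forall>\<^sub>F m in p. \<forall>i\<in>{..N}. c (n + m + (j + i)) = f i \<and> c (2 * (n + m + (j + i))) = g i"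
    unfolding eventually_ball_finite_distrib[OF finite_atMost] eventually_conj_iff
    using f1 g1 by blast
  then have "\<forall>\<^sub>F n in p. \<forall>\<^sub>F m in p. \<Phi> (\<lambda>i. c (n + m + j + i)) (\<lambda>i. c (2 * (n + m + j + i))) = \<Phi> f g"
    by (elim eventually_mono) (intro local; simp add: add.assoc)
  then have 1: "(\<forall>\<^sub>F n in p. \<forall>\<^sub>F m in p. \<Phi> (\<lambda>i. c (n + m + j + i)) (\<lambda>i. c (2 * (n + m + j + i)))) = \<Phi> f g"
    using ultra_eventually_iff[OF ultra_fsum[OF p(1) p(1)], of "\<lambda>n. \<Phi> (\<lambda>i. c (n + j + i)) (\<lambda>i. c (2 * (n + j + i)))"]
    by (simp add: eventually_fsum)
  have "\<forall>\<^sub>F n in p. \<forall>i\<in>{..N}. c (2 * n + (j + i)) = (\<not> f i) \<and> c (2 * (2 * n + (j + i))) = (\<not> g i)"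
    by (intro eventually_ball_finite ballI eventually_conj f2 g2 finite_atMost)
  then have "\<forall>\<^sub>F n in p. \<Psi> (\<lambda>i. c (2 * n + j + i)) (\<lambda>i. c (2 * (2 * n + j + i))) = \<Phi> f g"
  proof eventually_elim
    case (elim n)
    have "\<Psi> (\<lambda>i. c (2 * n + j + i)) (\<lambda>i. c (2 * (2 * n + j + i)))
        = \<Phi> (\<lambda>i. \<not> c (2 * n + j + i)) (\<lambda>i. \<not> c (2 * (2 * n + j + i)))"
      using neg[of "\<lambda>i. \<not> c (2 * n + j + i)" "\<lambda>i. \<not> c (2 * (2 * n + j + i))"] by simp
    also have "\<dots> = \<Phi> f g"
      using elim by (intro local) (simp_all add: add.assoc)
    finally show ?case .
  qed
  then have "(\<forall>\<^sub>F n in p. \<Psi> (\<lambda>i. c (2 * n + j + i)) (\<lambda>i. c (2 * (2 * n + j + i)))) = \<Phi> f g"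
    by (rule ultra_eventually_iff[OF p(1)])
  with 1 show "(\<forall>\<^sub>F n in p. \<forall>\<^sub>F m in p. \<Phi> (\<lambda>i. c (n + m + j + i)) (\<lambda>i. c (2 * (n + m + j + i))))
    = (\<forall>\<^sub>F n in p. \<Psi> (\<lambda>i. c (2 * n + j + i)) (\<lambda>i. c (2 * (2 * n + j + i))))" by simp
qed

text \<open>
  The block of length \<open>L + 1\<close> at the beginning of \<open>x\<close> recurs in \<open>x\<close> within every \<open>K + 1\<close> steps; \<open>occ\<close> marks
  its occurrences up to complementation. The set \<open>A v\<close> consists of the \<open>n\<close> such that \<open>c (2 * m) = v\<close> at all
  occurrences \<open>m\<close> of the block in \<open>c\<close> between \<open>n\<close> and \<open>n + K\<close>, of which there is at least one.
\<close>

theorem not_self_doubling: "\<not> doubles c (\<lambda>n. \<not> c n)"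
proof
  assume c: "doubles c (\<lambda>n. \<not> c n)"
  obtain p where p: "ultra p" "p \<le> sequentially" "fsum p p = p"
    and rec: "\<And>W. eventually W p \<Longrightarrow> \<exists>K. \<forall>i. \<exists>k\<le>K. \<forall>\<^sub>F n in p. W (n + i + k)"
    using uniformly_recurrent_idempotent by metis
  define x where "x j \<longleftrightarrow> (\<forall>\<^sub>F n in p. c (n + j))" for j
  have cx: "\<forall>\<^sub>F n in p. c (n + j) = x j" for j
    unfolding x_def by (rule ultra_eventually_eq[OF p(1)])
  have xx: "\<forall>\<^sub>F n in p. x (n + j) = x j" for j
  proof -
    have "x j = (\<forall>\<^sub>F n in p. \<forall>\<^sub>F m in p. c (n + m + j))"
      unfolding x_def by (subst (1) p(3)[symmetric]) (simp add: eventually_fsum)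
    also have "\<dots> = (\<forall>\<^sub>F n in p. x (n + j))"
      unfolding x_def by (simp add: ac_simps)
    finally show ?thesis
      using ultra_eventually_eq[OF p(1), of "\<lambda>n. x (n + j)"] by simp
  qed
  obtain L where L: "\<And>n \<sigma>. n \<ge> L \<Longrightarrow> \<forall>j\<le>L. c (n + j) = (x j = \<sigma>) \<Longrightarrow> c (2 * n) \<noteq> (x n = \<sigma>)"
    using doubles_compactness[OF c] by metis
  define occ where "occ f k \<longleftrightarrow> (\<exists>\<sigma>. \<forall>j\<le>L. f (k + j) = (x j = \<sigma>))" for f :: "nat \<Rightarrow> bool" and k
  have "\<forall>\<^sub>F n in p. \<forall>j\<in>{..L}. c (n + j) = x j"
    using cx by (simp add: eventually_ball_finite_distrib)
  from rec[OF this] obtain K where K: "\<And>i. \<exists>k\<le>K. \<forall>\<^sub>F n in p. \<forall>j\<in>{..L}. c (n + i + k + j) = x j" by blast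
  have occx: "\<exists>k\<le>K. occ x (i + k)" for i
  proof -
    obtain k where k: "k \<le> K" "\<forall>\<^sub>F n in p. \<forall>j\<in>{..L}. c (n + i + k + j) = x j" using K by blast
    have "x (i + k + j) = x j" if "j \<le> L" for j
      unfolding x_def[of "i + k + j"]
      by (rule ultra_eventually_iff[OF p(1)], rule eventually_mono[OF k(2)])
         (use that in \<open>simp add: add.assoc\<close>)
    then show ?thesis using k(1) by (auto simp: occ_def intro!: exI[of _ k] exI[of _ True])
  qed
  define \<Phi> where "\<Phi> v f g \<longleftrightarrow> (\<exists>k\<le>K. occ f k) \<and> (\<forall>k\<le>K. occ f k \<longrightarrow> g k = v)"
    for v and f g :: "nat \<Rightarrow> bool"
  have occ_neg: "occ (\<lambda>i. \<not> f i) = occ f" for f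
  proof (intro ext iffI)
    fix k assume "occ f k"
    then obtain \<sigma> where "\<forall>j\<le>L. f (k + j) = (x j = \<sigma>)" by (auto simp: occ_def)
    then show "occ (\<lambda>i. \<not> f i) k" by (auto simp: occ_def intro!: exI[of _ "\<not> \<sigma>"])
  next
    fix k assume "occ (\<lambda>i. \<not> f i) k"
    then obtain \<sigma> where "\<forall>j\<le>L. (\<not> f (k + j)) = (x j = \<sigma>)" by (auto simp: occ_def)
    then show "occ f k" by (auto simp: occ_def intro!: exI[of _ "\<not> \<sigma>"])
  qed
  have \<Phi>_neg: "\<Phi> v (\<lambda>i. \<not> f i) (\<lambda>i. \<not> g i) = \<Phi> (\<not> v) f g" for v f g
    unfolding \<Phi>_def occ_neg by auto
  have \<Phi>_local: "\<Phi> v f g = \<Phi> v f' g'" if "\<forall>i\<le>K + L. f i = f' i" "\<forall>i\<le>K + L. g i = g' i" for v f g f' g'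
  proof -
    have "occ f k = occ f' k" if "k \<le> K" for k
      using \<open>\<forall>i\<le>K + L. f i = f' i\<close> that by (auto simp: occ_def)
    then show ?thesis using that(2) by (auto simp: \<Phi>_def)
  qed
  define A where "A v n = \<Phi> v (\<lambda>i. c (n + i)) (\<lambda>i. c (2 * (n + i)))" for v n
  have dbl: "doubles (A v) (A (\<not> v))" for v
    unfolding A_def by (rule doubles_window[OF c, of "K + L"]) (simp_all add: \<Phi>_local \<Phi>_neg)
  have "\<exists>h N. \<forall>n\<ge>N. \<exists>i\<le>h. \<not> A (\<not> x 0) (n + i)"
  proof (rule no_doubling_runs)
    show "\<not> (A (\<not> x 0) n \<and> A (\<not> \<not> x 0) n)" for n by (auto simp: A_def \<Phi>_def)
  qed (use dbl[of "\<not> x 0"] dbl[of "\<not> \<not> x 0"] in simp_all)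
  then obtain h N where hN: "\<And>n. n \<ge> N \<Longrightarrow> \<exists>i\<le>h. \<not> A (\<not> x 0) (n + i)" by blast
  have "\<forall>\<^sub>F n in p. max N L \<le> n \<and> (\<forall>i\<in>{..h + K + L}. c (n + i) = x i \<and> x (n + i) = x i)"
    by (intro eventually_conj eventually_ge_nonprincipal[OF p(2)] eventually_ball_finite ballI cx xx finite_atMost)
  then obtain n where n: "n \<ge> N" "n \<ge> L"
    and near: "\<And>i. i \<le> h + K + L \<Longrightarrow> c (n + i) = x i \<and> x (n + i) = x i"
    using eventually_happens' ultra_neq_bot[OF p(1)] by fastforce
  \<comment> \<open>At an occurrence \<open>n + i + k\<close> the colour of the double is opposite to \<open>x (n + i + k) = \<sigma>\<close>. As \<open>n\<close> is
      typical for the idempotent, \<open>x (n + i + k) = x (i + k) = c (n + i + k)\<close>, and this is \<open>x 0 = \<sigma>\<close>.\<close>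
  have "A (\<not> x 0) (n + i)" if i: "i \<le> h" for i
    unfolding A_def \<Phi>_def
  proof (intro conjI allI impI)
    obtain k where k: "k \<le> K" "occ x (i + k)" using occx by blast
    then have "occ (\<lambda>j. c (n + i + j)) k"
      using i near by (auto simp: occ_def add.assoc)
    then show "\<exists>k\<le>K. occ (\<lambda>j. c (n + i + j)) k" using k(1) by blast
  next
    fix k assume k: "k \<le> K" "occ (\<lambda>j. c (n + i + j)) k"
    then obtain \<sigma> where \<sigma>: "\<forall>j\<le>L. c (n + i + k + j) = (x j = \<sigma>)" by (auto simp: occ_def add.assoc)
    then have "c (2 * (n + i + k)) \<noteq> (x (n + (i + k)) = \<sigma>)"
      using L[of "n + i + k" \<sigma>] n(2) by (simp add: add.assoc)
    moreover have "x (n + (i + k)) = x (i + k)" "c (n + (i + k)) = x (i + k)"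
      using near[of "i + k"] i k(1) by auto
    moreover have "c (n + (i + k)) = (x 0 = \<sigma>)"
      using \<sigma> by (metis add.assoc add_0_right le0)
    ultimately show "c (2 * (n + i + k)) = (\<not> x 0)"
      by auto
  qed
  then show False using hN[OF n(1)] by blast
qed

section \<open>The sumset theorem\<close>

theorem theorem1p1:
  fixes C :: "nat \<Rightarrow> nat set"
  assumes "C 1 \<union> C 2 = {1..}"
    and "C 1 \<inter> C 2 = {}"
  shows "\<exists>i\<in>{1, 2}. \<exists>B\<subseteq>{1..}. infinite B \<and> B + B \<subseteq> C i"
proof -
  define c where "c n \<longleftrightarrow> 2 * n \<in> C 1" for n
  obtain j v S where S: "infinite S" "\<And>n m. n \<in> S \<Longrightarrow> m \<in> S \<Longrightarrow> c (n + m + j) = v"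
    using not_doubles_imp_sumset[OF not_self_doubling[of c]] by metis
  \<comment> \<open>Dropping \<open>0\<close> keeps \<open>B\<close> within the positive integers when \<open>j = 0\<close>.\<close>
  define B where "B = (\<lambda>n. 2 * n + j) ` (S - {0})"
  have "infinite B"
    unfolding B_def using S(1) by (subst finite_image_iff) (auto simp: inj_on_def)
  moreover have "B \<subseteq> {1..}" by (auto simp: B_def)
  moreover have "B + B \<subseteq> C (if v then 1 else 2)"
  proof
    fix s assume "s \<in> B + B"
    then obtain n m where nm: "n \<in> S" "m \<in> S" "n \<noteq> 0" and s: "s = 2 * (n + m + j)"
      by (auto simp: B_def set_plus_def algebra_simps)
    have "s \<in> C 1 \<union> C 2" using assms(1) s nm(3) by simp
    then show "s \<in> C (if v then 1 else 2)"
      using S(2)[OF nm(1,2)] s by (auto simp: c_def)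
  qed
  ultimately show ?thesis
    by (intro bexI[of _ "if v then 1 else 2"] exI[of _ B] conjI) simp_all
qed

end
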